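(* Let $\alpha\ge 1$, $\beta\ge 1$ and $w\ge 0$ be integers, and let $p_0,p_1,\ldots,p_\alpha,q_1,\ldots,q_\beta$ be weights with $p_\alpha\neq 0$ and $q_\beta\neq 0$. For integers $0\le u,v\le w$, let $\Omega_{(u,v),n}$ be the set of $n$-step paths in the slit $\mathbb{Z}\times\{0,1,\ldots,w\}$ from $(0,u)$ to $(n,v)$ whose steps are of the form $(1,a)$ with $0\le a\le\alpha$ or $(1,-b)$ with $1\le b\le\beta$, where the weight $\omega_\varphi$ of a path $\varphi$ is the product of the weights of its steps (a step $(1,a)$ has weight $p_a$, a step $(1,-b)$ has weight $q_b$). Let \[ G_{(u,v)}^{w,\alpha,\beta}(t)=\sum_{n\ge 0}t^n\sum_{\varphi\in\Omega_{(u,v),n}}\omega_\varphi . \] Let $\bar z=(z_1,\ldots,z_{\alpha+\beta})$ be the $\alpha+\beta$ roots (in $z$) of the kernel \[ K(t,z)=1-t\sum_{a=0}^{\alpha}p_az^a-t\sum_{b=1}^{\beta}q_bz^{-b}. \] Then \[ G_{(u,v)}^{w,\alpha,\beta}(t)=\frac{(-1)^{1-\alpha}}{t\,p_{\alpha}}\,\frac{s_{(w^{\alpha},u,0^{\beta-1})/(v,0^{\alpha+\beta-1})}(\bar{z})}{s_{((w+1)^{\alpha},0^{\beta})}(\bar{z})}. \]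
   Context: The roots $z_1,\ldots,z_{\alpha+\beta}$ are the roots of the polynomial $z^\beta K(t,z)$ of degree $\alpha+\beta$ in $z$, taken in an algebraic closure of the field of rational functions in $t$ (or as functions of $t$); the identity is an identity of (rational) functions of $t$. For a partition $\lambda$ and a partition $\mu\subseteq\lambda$, $s_{\lambda/\mu}$ denotes the skew Schur function (and $s_\lambda$ the Schur function) in the $\alpha+\beta$ variables $\bar z$. The notation $(w^{\alpha},u,0^{\beta-1})$ denotes the partition with $\alpha$ parts equal to $w$, one part equal to $u$, and $\beta-1$ parts equal to $0$; similarly for the other partitions. Steps with height not occurring in the step set are modelled by assigning weight zero. *)

theory Defs
  imports
    "HOL-Algebra.Algebraic_Closure_Type"
    "HOL-Computational_Algebra.Computational_Algebra"
    "HOL-Library.FuncSet"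
begin

section \<open>Paths in a slit\<close>

text \<open>
  A path with \<open>n\<close> steps starting in \<open>(0, u)\<close> is encoded by the list of its height increments:
  the entry \<open>d\<close> stands for the step \<open>(1, d)\<close>, so that after \<open>k\<close> steps the path is in the point
  \<open>(k, u + sum_list (take k ds))\<close>.
\<close>

definition slit_paths :: "nat \<Rightarrow> nat \<Rightarrow> nat \<Rightarrow> nat \<Rightarrow> nat \<Rightarrow> nat \<Rightarrow> int list set" where
  "slit_paths w \<alpha> \<beta> u v n =
     {ds. length ds = n \<and> set ds \<subseteq> {- int \<beta>..int \<alpha>} \<and>
          (\<forall>k\<le>n. int u + sum_list (take k ds) \<in> {0..int w}) \<and>
          int u + sum_list ds = int v}"

definition step_weight :: "(nat \<Rightarrow> 'a) \<Rightarrow> (nat \<Rightarrow> 'a) \<Rightarrow> int \<Rightarrow> 'a" where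
  "step_weight p q d = (if d \<ge> 0 then p (nat d) else q (nat (- d)))"

definition path_weight :: "(nat \<Rightarrow> 'a :: comm_monoid_mult) \<Rightarrow> (nat \<Rightarrow> 'a) \<Rightarrow> int list \<Rightarrow> 'a" where
  "path_weight p q ds = prod_list (map (step_weight p q) ds)"

lemma finite_slit_paths: "finite (slit_paths w \<alpha> \<beta> u v n)"
proof (rule finite_subset)
  show "slit_paths w \<alpha> \<beta> u v n \<subseteq> {ds. set ds \<subseteq> {- int \<beta>..int \<alpha>} \<and> length ds = n}"
    by (auto simp: slit_paths_def)
qed (rule finite_lists_length_eq, simp)

definition slit_gf ::
    "nat \<Rightarrow> nat \<Rightarrow> nat \<Rightarrow> (nat \<Rightarrow> 'a :: comm_ring_1) \<Rightarrow> (nat \<Rightarrow> 'a) \<Rightarrow> nat \<Rightarrow> nat \<Rightarrow> 'a fps" where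
  "slit_gf w \<alpha> \<beta> p q u v = Abs_fps (\<lambda>n. \<Sum>ds\<in>slit_paths w \<alpha> \<beta> u v n. path_weight p q ds)"


section \<open>Skew Schur functions\<close>

text \<open>
  A partition is a weakly decreasing list of naturals, implicitly continued by zeros.
  Rows and columns of diagrams are counted from 0. The definitions below are meant for
  partitions \<open>\<mu> \<subseteq> \<lambda>\<close>.
\<close>

definition part :: "nat list \<Rightarrow> nat \<Rightarrow> nat" where
  "part lam i = (if i < length lam then lam ! i else 0)"

definition skew_diagram :: "nat list \<Rightarrow> nat list \<Rightarrow> (nat \<times> nat) set" where
  "skew_diagram lam mu = {(i, j). part mu i \<le> j \<and> j < part lam i}"

text \<open>
  Semistandard tableaux with entries in \<open>{1..N}\<close>: rows weakly increase and columns
  strictly increase. They are extensional functions, so there are only finitely many.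
\<close>

definition ssyt :: "nat \<Rightarrow> nat list \<Rightarrow> nat list \<Rightarrow> (nat \<times> nat \<Rightarrow> nat) set" where
  "ssyt N lam mu =
     {T \<in> skew_diagram lam mu \<rightarrow>\<^sub>E {1..N}.
        (\<forall>i j j'. (i, j) \<in> skew_diagram lam mu \<and> (i, j') \<in> skew_diagram lam mu \<and> j < j'
           \<longrightarrow> T (i, j) \<le> T (i, j')) \<and>
        (\<forall>i i' j. (i, j) \<in> skew_diagram lam mu \<and> (i', j) \<in> skew_diagram lam mu \<and> i < i'
           \<longrightarrow> T (i, j) < T (i', j))}"

lemma finite_skew_diagram: "finite (skew_diagram lam mu)"
proof (rule finite_subset)
  show "skew_diagram lam mu \<subseteq> (SIGMA i:{..<length lam}. {..<part lam i})"
    by (auto simp: skew_diagram_def part_def split: if_splits)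
qed simp

lemma finite_ssyt: "finite (ssyt N lam mu)"
proof (rule finite_subset)
  show "ssyt N lam mu \<subseteq> skew_diagram lam mu \<rightarrow>\<^sub>E {1..N}"
    by (auto simp: ssyt_def)
qed (intro finite_PiE finite_skew_diagram, simp)

text \<open>The (skew) Schur function in the variables \<open>x 1, \<dots>, x N\<close>.\<close>

definition skew_schur ::
    "nat \<Rightarrow> nat list \<Rightarrow> nat list \<Rightarrow> (nat \<Rightarrow> 'b :: comm_ring_1) \<Rightarrow> 'b" where
  "skew_schur N lam mu x = (\<Sum>T\<in>ssyt N lam mu. \<Prod>c\<in>skew_diagram lam mu. x (T c))"

definition schur :: "nat \<Rightarrow> nat list \<Rightarrow> (nat \<Rightarrow> 'b :: comm_ring_1) \<Rightarrow> 'b" where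
  "schur N lam x = skew_schur N lam [] x"


section \<open>The kernel\<close>

definition kernel ::
    "nat \<Rightarrow> nat \<Rightarrow> (nat \<Rightarrow> 'b :: field) \<Rightarrow> (nat \<Rightarrow> 'b) \<Rightarrow> 'b \<Rightarrow> 'b \<Rightarrow> 'b" where
  "kernel \<alpha> \<beta> p q t z =
     1 - t * (\<Sum>a=0..\<alpha>. p a * z ^ a) - t * (\<Sum>b=1..\<beta>. q b * inverse z ^ b)"

text \<open>The polynomial \<open>z\<^sup>\<beta> K(t, z)\<close> in \<open>z\<close>.\<close>

definition kernel_poly ::
    "nat \<Rightarrow> nat \<Rightarrow> (nat \<Rightarrow> 'b :: field) \<Rightarrow> (nat \<Rightarrow> 'b) \<Rightarrow> 'b \<Rightarrow> 'b poly" where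
  "kernel_poly \<alpha> \<beta> p q t =
     monom 1 \<beta> - smult t (\<Sum>a=0..\<alpha>. monom (p a) (a + \<beta>))
               - smult t (\<Sum>b=1..\<beta>. monom (q b) (\<beta> - b))"

lemma poly_kernel_poly:
  assumes "z \<noteq> 0"
  shows "poly (kernel_poly \<alpha> \<beta> p q t) z = z ^ \<beta> * kernel \<alpha> \<beta> p q t z"
proof -
  have "z ^ (\<beta> - b) = z ^ \<beta> * inverse z ^ b" if "b \<in> {1..\<beta>}" for b
    using that assms by (simp add: power_diff power_inverse divide_inverse)
  then show ?thesis
    by (simp add: kernel_poly_def kernel_def poly_sum poly_monom algebra_simps power_add
        sum_distrib_left)
qed


section \<open>Rational functions of \<open>t\<close>, their algebraic closure and their expansions\<close>

type_synonym 'a ratfun_closure = "'a poly fract alg_closure"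

definition var_t :: "'a :: field ratfun_closure" where
  "var_t = to_ac (to_fract [:0, 1:])"

definition const_ac :: "'a :: field \<Rightarrow> 'a ratfun_closure" where
  "const_ac c = to_ac (to_fract [:c:])"

text \<open>
  \<open>R\<close> is the rational function represented by the power series \<open>G\<close>. Since the ring of
  power series has no zero divisors, \<open>R\<close> and \<open>G\<close> determine each other.
\<close>

definition ratfun_expansion :: "'a :: field poly fract \<Rightarrow> 'a fps \<Rightarrow> bool" where
  "ratfun_expansion R G \<longleftrightarrow>
     (\<exists>P Q. Q \<noteq> 0 \<and> R = to_fract P / to_fract Q \<and> fps_of_poly Q * G = fps_of_poly P)"

end

theory Submission
  imports Defs "Jordan_Normal_Form.Determinant"
begin

text \<open>
  The generating functions form the inverse of the Toeplitz matrix \<open>1 - t A\<close>, where \<open>A\<close> is the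
  step matrix on the heights \<open>0, \<dots>, w\<close>, so each of them is a cofactor over the determinant. The
  entry of \<open>1 - t A\<close> in row \<open>i\<close> and column \<open>j\<close> is the coefficient of \<open>z\<^sup>j\<^sup>-\<^sup>i\<close> in the kernel, hence by
  Vieta it equals \<open>- t p\<^sub>\<alpha> (-1)\<^sup>\<alpha>\<^sup>+\<^sup>i\<^sup>+\<^sup>j\<close> times the elementary symmetric polynomial of degree
  \<open>\<alpha> - j + i\<close> in the roots. Up to the scalars, determinant and cofactor are therefore the dual
  Jacobi-Trudi determinants of \<open>((w + 1)\<^sup>\<alpha>)\<close> and \<open>(w\<^sup>\<alpha>, u)/(v)\<close>.

  The dual Jacobi-Trudi identity follows by induction on the number of variables: both sides obey
  the same recursion in the last variable. For tableaux it comes from deleting the cells with the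
  largest entry, for determinants from multilinearity in the rows.
\<close>

section \<open>Tableaux on diagrams\<close>

text \<open>Arbitrary sets of cells are allowed, so that deleting the cells with the largest entry
  stays within the notion.\<close>

definition tableaux :: "nat \<Rightarrow> (nat \<times> nat) set \<Rightarrow> (nat \<times> nat \<Rightarrow> nat) set" where
  "tableaux N D =
     {T \<in> D \<rightarrow>\<^sub>E {1..N}.
        (\<forall>i j j'. (i, j) \<in> D \<and> (i, j') \<in> D \<and> j < j' \<longrightarrow> T (i, j) \<le> T (i, j')) \<and>
        (\<forall>i i' j. (i, j) \<in> D \<and> (i', j) \<in> D \<and> i < i' \<longrightarrow> T (i, j) < T (i', j))}"

definition tableau_sum :: "nat \<Rightarrow> (nat \<times> nat) set \<Rightarrow> (nat \<Rightarrow> 'b :: comm_ring_1) \<Rightarrow> 'b" where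
  "tableau_sum N D x = (\<Sum>T\<in>tableaux N D. \<Prod>c\<in>D. x (T c))"

lemma skew_schur_tableau_sum: "skew_schur N lam mu x = tableau_sum N (skew_diagram lam mu) x"
  by (simp add: skew_schur_def tableau_sum_def tableaux_def ssyt_def)

lemma tableauxI:
  assumes "T \<in> extensional D" and "\<And>c. c \<in> D \<Longrightarrow> 1 \<le> T c" and "\<And>c. c \<in> D \<Longrightarrow> T c \<le> N"
    and "\<And>i j j'. (i, j) \<in> D \<Longrightarrow> (i, j') \<in> D \<Longrightarrow> j < j' \<Longrightarrow> T (i, j) \<le> T (i, j')"
    and "\<And>i i' j. (i, j) \<in> D \<Longrightarrow> (i', j) \<in> D \<Longrightarrow> i < i' \<Longrightarrow> T (i, j) < T (i', j)"
  shows "T \<in> tableaux N D"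
  unfolding tableaux_def PiE_iff mem_Collect_eq using assms by simp

lemma tableauxD:
  assumes "T \<in> tableaux N D"
  shows "T \<in> D \<rightarrow>\<^sub>E {1..N}"
    and "(i, j) \<in> D \<Longrightarrow> (i, j') \<in> D \<Longrightarrow> j < j' \<Longrightarrow> T (i, j) \<le> T (i, j')"
    and "(i, j) \<in> D \<Longrightarrow> (i', j) \<in> D \<Longrightarrow> i < i' \<Longrightarrow> T (i, j) < T (i', j)"
  using assms by (auto simp: tableaux_def)

lemma finite_tableaux: "finite D \<Longrightarrow> finite (tableaux N D)"
  by (rule finite_subset[of _ "D \<rightarrow>\<^sub>E {1..N}"]) (auto simp: tableaux_def finite_PiE)

text \<open>The sets of cells that can carry the largest entry of a tableau.\<close>

definition end_strips :: "(nat \<times> nat) set \<Rightarrow> (nat \<times> nat) set set" where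
  "end_strips D =
     {H. H \<subseteq> D \<and>
        (\<forall>i j j'. (i, j) \<in> H \<and> (i, j') \<in> D \<and> j < j' \<longrightarrow> (i, j') \<in> H) \<and>
        (\<forall>i i' j. (i, j) \<in> H \<and> i < i' \<longrightarrow> (i', j) \<notin> D)}"

lemma end_stripsD:
  assumes "H \<in> end_strips D"
  shows "H \<subseteq> D"
    and "(i, j) \<in> H \<Longrightarrow> (i, j') \<in> D \<Longrightarrow> j < j' \<Longrightarrow> (i, j') \<in> H"
    and "(i, j) \<in> H \<Longrightarrow> i < i' \<Longrightarrow> (i', j) \<notin> D"
  using assms unfolding end_strips_def by blast+

lemma finite_end_strips: "finite D \<Longrightarrow> finite (end_strips D)"
  by (rule finite_subset[of _ "Pow D"]) (auto simp: end_strips_def)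

text \<open>Nothing larger than \<open>Suc N\<close> fits to the right of or below an entry
  \<open>Suc N\<close>, so these entries occupy an end strip. Conversely, an end strip can be filled
  with \<open>Suc N\<close> whatever tableau with entries at most \<open>N\<close> stands on the
  other cells.\<close>

lemma tableau_sum_Suc:
  fixes x :: "nat \<Rightarrow> 'b :: comm_ring_1"
  assumes fin: "finite D"
  shows "tableau_sum (Suc N) D x =
    (\<Sum>H\<in>end_strips D. x (Suc N) ^ card H * tableau_sum N (D - H) x)"
proof -
  define fill where
    "fill = (\<lambda>(H, T). \<lambda>c\<in>D. if c \<in> H then Suc N else T c :: nat)"
  define top where "top = (\<lambda>T. {c \<in> D. T c = Suc N})"
  have "tableau_sum (Suc N) D x =
    (\<Sum>(H, T)\<in>(SIGMA H:end_strips D. tableaux N (D - H)).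
       x (Suc N) ^ card H * (\<Prod>c\<in>D - H. x (T c)))"
    unfolding tableau_sum_def
  proof (rule sum.reindex_bij_witness[of _ fill "\<lambda>T. (top T, restrict T (D - top T))"])
    fix T assume T: "T \<in> tableaux (Suc N) D"
    note PiE = tableauxD(1)[OF T]
    then have le: "T c \<le> Suc N" "T c \<ge> 1" if "c \<in> D" for c
      using that by (auto simp: PiE_iff)
    show "fill (top T, restrict T (D - top T)) = T"
      using PiE by (auto simp: fill_def top_def fun_eq_iff PiE_iff extensional_def)
    have "top T \<in> end_strips D"
    proof -
      have "T (i, j') = Suc N" if "(i, j) \<in> D" "T (i, j) = Suc N" "(i, j') \<in> D" "j < j'" for i j j'
      proof -
        have "T (i, j) \<le> T (i, j')" using tableauxD(2)[OF T] that by blast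
        with le(1)[OF that(3)] that(2) show ?thesis by simp
      qed
      moreover have False if "(i, j) \<in> D" "T (i, j) = Suc N" "(i', j) \<in> D" "i < i'" for i i' j
      proof -
        have "T (i, j) < T (i', j)" using tableauxD(3)[OF T] that by blast
        with le(1)[OF that(3)] that(2) show ?thesis by simp
      qed
      ultimately show ?thesis unfolding end_strips_def top_def by blast
    qed
    moreover have "restrict T (D - top T) \<in> tableaux N (D - top T)"
    proof -
      have "T c \<le> N" if "c \<in> D - top T" for c
        using le(1)[of c] that by (auto simp: top_def le_Suc_eq)
      moreover have "restrict T (D - top T) \<in> extensional (D - top T)" by simp
      ultimately show ?thesis
        using le(2) tableauxD(2,3)[OF T] by (intro tableauxI) auto
    qed
    ultimately show "(top T, restrict T (D - top T))
        \<in> (SIGMA H:end_strips D. tableaux N (D - H))" by simp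
    have "(\<Prod>c\<in>D. x (T c)) = (\<Prod>c\<in>top T. x (T c)) * (\<Prod>c\<in>D - top T. x (T c))"
      by (subst prod.subset_diff[of "top T" D]) (auto simp: fin top_def mult.commute)
    also have "(\<Prod>c\<in>top T. x (T c)) = x (Suc N) ^ card (top T)"
      by (simp add: top_def)
    finally show "(case (top T, restrict T (D - top T)) of
         (H, T) \<Rightarrow> x (Suc N) ^ card H * (\<Prod>c\<in>D - H. x (T c))) = (\<Prod>c\<in>D. x (T c))"
      by (auto intro!: arg_cong2[of _ _ _ _ "(*)"] prod.cong)
  next
    fix HT assume "HT \<in> (SIGMA H:end_strips D. tableaux N (D - H))"
    then obtain H T where HT: "HT = (H, T)" and H: "H \<in> end_strips D"
      and T: "T \<in> tableaux N (D - H)" by auto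
    note HD = end_stripsD[OF H]
    note PiE = tableauxD(1)[OF T]
    have le: "T c \<le> N" "T c \<ge> 1" if "c \<in> D" "c \<notin> H" for c
      using PiE that by (auto simp: PiE_iff)
    have "T c \<noteq> Suc N" if "c \<in> D" "c \<notin> H" for c using le(1)[OF that] by simp
    then have top: "top (fill HT) = H"
      using HD(1) by (auto simp: HT fill_def top_def split: if_splits)
    have "restrict (fill HT) (D - H) = T"
      using PiE by (auto simp: HT fill_def fun_eq_iff PiE_iff extensional_def)
    then show "(top (fill HT), restrict (fill HT) (D - top (fill HT))) = HT"
      unfolding top by (simp add: HT)
    have "fill HT (i, j) \<le> fill HT (i, j')" if "(i, j) \<in> D" "(i, j') \<in> D" "j < j'" for i j j'
    proof (cases "(i, j') \<in> H")
      case True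
      with that show ?thesis using le(1)[of "(i, j)"] by (auto simp: HT fill_def)
    next
      case False
      then have "(i, j) \<notin> H" using HD that by blast
      moreover have "T (i, j) \<le> T (i, j')"
        using tableauxD(2)[OF T] that False \<open>(i, j) \<notin> H\<close> by blast
      ultimately show ?thesis using that False by (auto simp: HT fill_def)
    qed
    moreover have "fill HT (i, j) < fill HT (i', j)"
      if "(i, j) \<in> D" "(i', j) \<in> D" "i < i'" for i i' j
    proof -
      have "(i, j) \<notin> H" using HD that by blast
      then show ?thesis
      proof (cases "(i', j) \<in> H")
        case True
        with that \<open>(i, j) \<notin> H\<close> show ?thesis
          using le(1)[of "(i, j)"] by (auto simp: HT fill_def)
      next
        case False
        moreover have "T (i, j) < T (i', j)"
          using tableauxD(3)[OF T] that False \<open>(i, j) \<notin> H\<close> by blast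
        ultimately show ?thesis using that \<open>(i, j) \<notin> H\<close> by (auto simp: HT fill_def)
      qed
    qed
    moreover have "fill HT \<in> extensional D" "\<And>c. c \<in> D \<Longrightarrow> 1 \<le> fill HT c"
      "\<And>c. c \<in> D \<Longrightarrow> fill HT c \<le> Suc N"
      using le by (auto simp: HT fill_def le_SucI)
    ultimately show "fill HT \<in> tableaux (Suc N) D" by (intro tableauxI)
  qed
  also have "\<dots> = (\<Sum>H\<in>end_strips D. x (Suc N) ^ card H * tableau_sum N (D - H) x)"
    by (subst sum.Sigma[symmetric])
       (auto simp: finite_end_strips fin finite_tableaux tableau_sum_def sum_distrib_left)
  finally show ?thesis .
qed

section \<open>The dual Jacobi-Trudi identity\<close>

text \<open>Integer degrees let the recursion hold without exceptions; degrees outside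
  \<open>0..N\<close> give the zero entries of the determinants below.\<close>

fun elem_sym :: "(nat \<Rightarrow> 'b :: comm_ring_1) \<Rightarrow> nat \<Rightarrow> int \<Rightarrow> 'b" where
  "elem_sym x 0 m = (if m = 0 then 1 else 0)"
| "elem_sym x (Suc N) m = elem_sym x N m + x (Suc N) * elem_sym x N (m - 1)"

lemma elem_sym_neg: "m < 0 \<Longrightarrow> elem_sym x N m = 0"
  by (induction N arbitrary: m) auto

lemma elem_sym_gt: "m > int N \<Longrightarrow> elem_sym x N m = 0"
  by (induction N arbitrary: m) auto

text \<open>Vieta's formulas. Beyond the degree the argument is negative, so both sides
  vanish.\<close>

lemma coeff_prod_linear_factors:
  fixes x :: "nat \<Rightarrow> 'b :: comm_ring_1"
  shows "coeff (\<Prod>i=1..N. [:- x i, 1:]) k = (- 1) ^ (N + k) * elem_sym x N (int N - int k)"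
proof (induction N arbitrary: k)
  case 0
  then show ?case by (auto simp: coeff_pCons split: nat.split)
next
  case (Suc N)
  note IH = Suc.IH[unfolded One_nat_def]
  show ?case
  proof (cases k)
    case 0
    then show ?thesis
      by (simp add: IH elem_sym_gt mult.commute[of _ "[:- x (Suc N), 1:]"])
  next
    case (Suc k')
    then show ?thesis
      by (simp add: IH mult.commute[of _ "[:- x (Suc N), 1:]"] algebra_simps)
  qed
qed

text \<open>Row and column shifts are separate sequences, so that lowering a row of a dual
  Jacobi-Trudi matrix only changes \<open>l\<close>.\<close>

definition minor :: "(int \<Rightarrow> 'b :: comm_ring_1) \<Rightarrow> nat \<Rightarrow> (nat \<Rightarrow> int) \<Rightarrow> (nat \<Rightarrow> int) \<Rightarrow> 'b" where
  "minor f n l m = det (mat n n (\<lambda>(i, j). f (l i - m j)))"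

lemma det_mat:
  "det (mat n n f) = (\<Sum>p | p permutes {0..<n}. signof p * (\<Prod>i = 0..<n. f (i, p i)))"
  by (subst det_def') (auto intro!: sum.cong prod.cong simp: permutes_in_image)

lemma minor_cong:
  assumes "\<And>i. i < n \<Longrightarrow> l i = l' i" "\<And>i. i < n \<Longrightarrow> m i = m' i"
  shows "minor f n l m = minor f n l' m'"
  unfolding minor_def by (intro arg_cong[of _ _ det] eq_matI) (auto simp: assms)

text \<open>By the recursion of \<open>elem_sym\<close>, each row is the sum of the same row for
  \<open>N\<close> variables and \<open>x (Suc N)\<close> times that row with its shift lowered by
  1. Multilinearity, carried out on the Leibniz products, leaves the choice \<open>S\<close> of
  lowered rows.\<close>

lemma minor_elem_sym_Suc:
  "minor (elem_sym x (Suc N)) n l m =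
    (\<Sum>S\<in>Pow {0..<n}. x (Suc N) ^ card S *
       minor (elem_sym x N) n (\<lambda>i. l i - of_bool (i \<in> S)) m)"
proof -
  have "(\<Prod>i=0..<n. elem_sym x (Suc N) (l i - m (p i))) =
      (\<Sum>S\<in>Pow {0..<n}. x (Suc N) ^ card S *
         (\<Prod>i=0..<n. elem_sym x N (l i - of_bool (i \<in> S) - m (p i))))" for p
  proof -
    have "(\<Prod>i=0..<n. elem_sym x (Suc N) (l i - m (p i))) =
      (\<Prod>i=0..<n. x (Suc N) * elem_sym x N (l i - 1 - m (p i)) + elem_sym x N (l i - m (p i)))"
      by (simp add: algebra_simps)
    also have "\<dots> = (\<Sum>S\<in>Pow {0..<n}. (\<Prod>i\<in>S. x (Suc N) * elem_sym x N (l i - 1 - m (p i))) *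
        (\<Prod>i\<in>{0..<n} - S. elem_sym x N (l i - m (p i))))"
      by (rule prod_add) simp
    also have "\<dots> = (\<Sum>S\<in>Pow {0..<n}. x (Suc N) ^ card S *
         (\<Prod>i=0..<n. elem_sym x N (l i - of_bool (i \<in> S) - m (p i))))"
    proof (rule sum.cong)
      fix S assume S: "S \<in> Pow {0..<n}"
      have "(\<Prod>i=0..<n. elem_sym x N (l i - of_bool (i \<in> S) - m (p i))) =
        (\<Prod>i\<in>{0..<n} - S. elem_sym x N (l i - of_bool (i \<in> S) - m (p i))) *
        (\<Prod>i\<in>S. elem_sym x N (l i - of_bool (i \<in> S) - m (p i)))"
        using S by (intro prod.subset_diff) auto
      also have "\<dots> = (\<Prod>i\<in>{0..<n} - S. elem_sym x N (l i - m (p i))) *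
        (\<Prod>i\<in>S. elem_sym x N (l i - 1 - m (p i)))"
        by (intro arg_cong2[of _ _ _ _ "(*)"] prod.cong) auto
      finally show "(\<Prod>i\<in>S. x (Suc N) * elem_sym x N (l i - 1 - m (p i))) *
        (\<Prod>i\<in>{0..<n} - S. elem_sym x N (l i - m (p i))) = x (Suc N) ^ card S *
         (\<Prod>i=0..<n. elem_sym x N (l i - of_bool (i \<in> S) - m (p i)))"
        by (simp add: prod.distrib mult_ac)
    qed simp
    finally show ?thesis .
  qed
  then show ?thesis
    unfolding minor_def det_mat prod.case
    by (simp only: sum_distrib_left mult.left_commute[of _ "x (Suc N) ^ _"] sum.swap[of _ _ "Pow _"])
qed

lemma minor_eq_0_repeated:
  assumes "i < n" "j < n" "i \<noteq> j" "l i = l j"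
  shows "minor f n l m = 0"
  unfolding minor_def
  by (rule det_identical_rows[of _ n i j]) (use assms in \<open>auto intro!: eq_vecI\<close>)

text \<open>The entries in the rows from \<open>k\<close> on and the columns up to \<open>k\<close>
  vanish, so \<open>n - k\<close> rows would have to be matched with the \<open>n - k - 1\<close>
  columns after \<open>k\<close>.\<close>

lemma minor_eq_0_block:
  assumes k: "k < n" and f: "\<And>d. d < 0 \<Longrightarrow> f d = 0"
    and l: "\<And>i. k \<le> i \<Longrightarrow> i < n \<Longrightarrow> l i \<le> l k" and m: "\<And>j. j \<le> k \<Longrightarrow> m k \<le> m j"
    and less: "l k < m k"
  shows "minor f n l m = 0"
proof -
  have "(\<Prod>i=0..<n. f (l i - m (p i))) = 0" if p: "p permutes {0..<n}" for p
  proof -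
    have "\<not> p ` {k..<n} \<subseteq> {Suc k..<n}"
    proof
      assume "p ` {k..<n} \<subseteq> {Suc k..<n}"
      then have "card (p ` {k..<n}) \<le> card {Suc k..<n}" by (intro card_mono) auto
      moreover have "card (p ` {k..<n}) = card {k..<n}"
        using permutes_inj[OF p] by (intro card_image) (auto simp: inj_on_def)
      ultimately show False using k by simp
    qed
    moreover have "p i < n" if "i < n" for i using permutes_in_image[OF p, of i] that by simp
    ultimately obtain i where i: "k \<le> i" "i < n" "p i \<le> k" by fastforce
    have "l i - m (p i) < 0" using l[of i] m[of "p i"] less i by simp
    then show ?thesis using i by (intro prod_zero) (auto intro!: bexI[of _ i] f)
  qed
  then show ?thesis by (simp add: minor_def det_mat)
qed

text \<open>Columns instead of rows: each column of the diagram becomes a row of the determinant,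
  and an end strip meets a column in at most one cell.\<close>

definition column_diagram :: "nat \<Rightarrow> (nat \<Rightarrow> nat) \<Rightarrow> (nat \<Rightarrow> nat) \<Rightarrow> (nat \<times> nat) set" where
  "column_diagram n b c = {(i, j). j < n \<and> b j \<le> i \<and> i < c j}"

lemma finite_column_diagram: "finite (column_diagram n b c)"
proof -
  have "column_diagram n b c = (\<Union>j<n. (\<lambda>i. (i, j)) ` {b j..<c j})"
    by (auto simp: column_diagram_def)
  then show ?thesis by simp
qed

lemma tableau_sum_0: "tableau_sum 0 D x = (if D = {} then 1 else 0)"
proof (cases "D = {}")
  case True
  then have "tableaux 0 D = {\<lambda>_. undefined}" by (auto simp: tableaux_def)
  with True show ?thesis by (simp add: tableau_sum_def)
next
  case False
  then have "tableaux 0 D = {}" by (auto simp: tableaux_def PiE_eq_empty_iff)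
  with False show ?thesis by (simp add: tableau_sum_def)
qed

text \<open>An end strip can only take last cells of columns, hence amounts to a set
  \<open>S\<close> of columns. Closure to the right says that with a column also all later ones
  ending in the same row belong to \<open>S\<close>; since \<open>b\<close> decreases, those columns
  do contain a cell in that row.\<close>

lemma sum_end_strips_column_diagram:
  assumes b: "\<And>i j. i \<le> j \<Longrightarrow> j < n \<Longrightarrow> b j \<le> b i"
    and c: "\<And>i j. i \<le> j \<Longrightarrow> j < n \<Longrightarrow> c j \<le> c i"
  shows "(\<Sum>H\<in>end_strips (column_diagram n b c). F (card H) (column_diagram n b c - H)) =
    (\<Sum>S | S \<subseteq> {j. j < n \<and> b j < c j} \<and> (\<forall>i j. i < j \<and> j < n \<and> c i = c j \<and> i \<in> S \<longrightarrow> j \<in> S).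
       F (card S) (column_diagram n b (\<lambda>j. c j - of_bool (j \<in> S))))"
    (is "sum ?f ?E = sum ?g ?S")
proof -
  define ends where "ends = (\<lambda>S. (\<lambda>j. (c j - 1, j)) ` S)"
  have snd_ends: "snd ` ends S = S" for S by (simp add: ends_def image_image)
  have ends_snd: "ends (snd ` H) = H" if H: "H \<in> ?E" for H
  proof -
    have "i = c j - 1" if ij: "(i, j) \<in> H" for i j
    proof (rule ccontr)
      assume "i \<noteq> c j - 1"
      moreover have "(i, j) \<in> column_diagram n b c" using end_stripsD(1)[OF H] ij by blast
      ultimately have "(c j - 1, j) \<in> column_diagram n b c" "i < c j - 1"
        by (auto simp: column_diagram_def)
      then show False using end_stripsD(3)[OF H ij] by blast
    qed
    then have "(\<lambda>h. (c (snd h) - 1, snd h)) ` H = id ` H" by (intro image_cong) auto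
    then show ?thesis by (simp add: ends_def image_image)
  qed
  \<comment> \<open>For \<open>c j = 0\<close> the column is empty, so truncated subtraction is
    harmless.\<close>
  have diff: "column_diagram n b c - ends S = column_diagram n b (\<lambda>j. c j - of_bool (j \<in> S))"
    for S
  proof -
    have "(i, j) \<in> ends S \<longleftrightarrow> j \<in> S \<and> i = c j - 1" for i j by (auto simp: ends_def)
    then show ?thesis by (auto simp: column_diagram_def set_eq_iff)
  qed
  have card_ends: "card (ends S) = card S" for S
    unfolding ends_def by (rule card_image) (auto simp: inj_on_def)
  show ?thesis
  proof (rule sum.reindex_bij_witness[of _ ends "\<lambda>H. snd ` H"])
    fix H assume H: "H \<in> ?E"
    show "ends (snd ` H) = H" using ends_snd[OF H] .
    have mem: "(c j - 1, j) \<in> H" if "j \<in> snd ` H" for j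
      using that ends_snd[OF H] by (auto simp: ends_def)
    note sub = end_stripsD(1)[OF H]
    have "j \<in> snd ` H" if "i < j" "j < n" "c i = c j" "i \<in> snd ` H" for i j
    proof -
      have "b i \<le> c i - 1" "c i - 1 < c i" using mem[OF that(4)] sub by (auto simp: column_diagram_def)
      then have "(c i - 1, j) \<in> column_diagram n b c"
        using b[of i j] that by (auto simp: column_diagram_def)
      then have "(c i - 1, j) \<in> H"
        using end_stripsD(2)[OF H mem[OF that(4)]] \<open>i < j\<close> by blast
      then show ?thesis by force
    qed
    moreover have "snd ` H \<subseteq> {j. j < n \<and> b j < c j}"
      using sub by (auto simp: column_diagram_def)
    ultimately show S: "snd ` H \<in> ?S" by blast
    show "?g (snd ` H) = ?f H"
      using diff[of "snd ` H"] card_ends[of "snd ` H"] by (simp add: ends_snd[OF H])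
  next
    fix S assume S: "S \<in> ?S"
    show "snd ` ends S = S" by (rule snd_ends)
    have mem: "j < n" "b j < c j" if "j \<in> S" for j using S that by auto
    have sub: "ends S \<subseteq> column_diagram n b c"
      using mem by (fastforce simp: ends_def column_diagram_def)
    have "(i, j') \<in> ends S"
      if ij: "(i, j) \<in> ends S" and ij': "(i, j') \<in> column_diagram n b c" and "j < j'" for i j j'
    proof -
      have "j \<in> S" and i: "i = c j - 1" using ij by (auto simp: ends_def)
      moreover have j': "i < c j'" "j' < n" using ij' by (auto simp: column_diagram_def)
      \<comment> \<open>Column \<open>j'\<close> reaches the last row of column \<open>j\<close> and
        is not longer.\<close>
      moreover have "c j' \<le> c j" using c[of j j'] \<open>j < j'\<close> j' by simp
      ultimately have "c j = c j'" using mem(2)[of j] by simp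
      then have "j' \<in> S" using S \<open>j \<in> S\<close> \<open>j < j'\<close> j' by blast
      then show ?thesis using i \<open>c j = c j'\<close> by (simp add: ends_def)
    qed
    moreover have "(i', j) \<notin> column_diagram n b c" if "(i, j) \<in> ends S" "i < i'" for i i' j
      using that by (auto simp: ends_def column_diagram_def)
    ultimately show "ends S \<in> ?E" using sub unfolding end_strips_def by blast
  qed
qed

lemma minor_eq_0_row:
  assumes "k < n" "\<And>j. j < n \<Longrightarrow> f (l k - m j) = 0"
  shows "minor f n l m = 0"
proof -
  have "(\<Prod>i=0..<n. f (l i - m (p i))) = 0" if p: "p permutes {0..<n}" for p
    using assms permutes_in_image[OF p, of k] by (intro prod_zero) (auto intro!: bexI[of _ k])
  then show ?thesis by (simp add: minor_def det_mat)
qed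

text \<open>
  The sequences \<open>b\<close> and \<open>c\<close> are the conjugates of the inner and the outer partition. Lowering \<open>c\<close> on a
  set \<open>S\<close> that is not a set of column ends of a horizontal strip gives either two equal rows or a
  zero block too large for a nonzero determinant.
\<close>

lemma dual_jacobi_trudi:
  fixes x :: "nat \<Rightarrow> 'b :: comm_ring_1"
  assumes b: "\<And>i j. i \<le> j \<Longrightarrow> j < n \<Longrightarrow> b j \<le> b i"
    and c: "\<And>i j. i \<le> j \<Longrightarrow> j < n \<Longrightarrow> c j \<le> c i"
    and bc: "\<And>j. j < n \<Longrightarrow> b j \<le> c j"
  shows "tableau_sum N (column_diagram n b c) x =
    minor (elem_sym x N) n (\<lambda>i. int (c i) - int i) (\<lambda>j. int (b j) - int j)"
  using c bc
proof (induction N arbitrary: c)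
  case 0
  show ?case
  proof (cases "\<forall>j<n. b j = c j")
    case True
    have "column_diagram n b c = {}" using True by (auto simp: column_diagram_def)
    \<comment> \<open>The shifts \<open>int (c i) - int i\<close> strictly decrease, so the argument
      vanishes only on the diagonal and the matrix is the identity.\<close>
    moreover have "int (c i) - int i - (int (b j) - int j) = 0 \<longleftrightarrow> i = j" if "i < n" "j < n" for i j
      using "0.prems"(1)[of i j] "0.prems"(1)[of j i] True that by (cases i j rule: linorder_cases) auto
    then have "elem_sym x 0 (int (c i) - int i - (int (b j) - int j)) = of_bool (i = j)"
      if "i < n" "j < n" for i j using that by (simp only: elem_sym.simps of_bool_def)
    then have "mat n n (\<lambda>(i, j). elem_sym x 0 (int (c i) - int i - (int (b j) - int j))) = 1\<^sub>m n"
      by (intro eq_matI) (auto simp del: elem_sym.simps)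
    ultimately show ?thesis by (simp add: tableau_sum_0 minor_def)
  next
    case False
    \<comment> \<open>In the first row \<open>k\<close> with \<open>b k \<noteq> c k\<close> every
      argument is nonzero: it is negative for \<open>j < k\<close>, where \<open>b j = c j\<close>,
      and positive from \<open>k\<close> on.\<close>
    define k where "k = (LEAST k. k < n \<and> b k \<noteq> c k)"
    have k: "k < n" "b k \<noteq> c k" using LeastI_ex[of "\<lambda>k. k < n \<and> b k \<noteq> c k"] False by (auto simp: k_def)
    have eq: "b j = c j" if "j < k" for j
      using not_less_Least[of j "\<lambda>k. k < n \<and> b k \<noteq> c k"] that k by (auto simp: k_def)
    have less: "b k < c k" using "0.prems"(2)[of k] k by simp
    have "(b k, k) \<in> column_diagram n b c" using k less by (auto simp: column_diagram_def)
    then have "column_diagram n b c \<noteq> {}" by blast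
    moreover have "int (c k) - int k - (int (b j) - int j) \<noteq> 0" if "j < n" for j
    proof (cases "j < k")
      case True
      then show ?thesis using eq[of j] "0.prems"(1)[of j k] k by simp
    next
      case False
      then show ?thesis using b[of k j] less that by simp
    qed
    then have "minor (elem_sym x 0) n (\<lambda>i. int (c i) - int i) (\<lambda>j. int (b j) - int j) = 0"
      using k by (intro minor_eq_0_row[of k]) auto
    ultimately show ?thesis by (simp add: tableau_sum_0 del: elem_sym.simps)
  qed
next
  case (Suc N)
  let ?m = "\<lambda>j. int (b j) - int j"
  let ?l = "\<lambda>S i. int (c i) - int i - of_bool (i \<in> S)"
  define G where
    "G = {S. S \<subseteq> {j. j < n \<and> b j < c j} \<and> (\<forall>i j. i < j \<and> j < n \<and> c i = c j \<and> i \<in> S \<longrightarrow> j \<in> S)}"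
  have "tableau_sum (Suc N) (column_diagram n b c) x =
    (\<Sum>S\<in>G. x (Suc N) ^ card S * tableau_sum N (column_diagram n b (\<lambda>j. c j - of_bool (j \<in> S))) x)"
    unfolding tableau_sum_Suc[OF finite_column_diagram] G_def
    by (rule sum_end_strips_column_diagram[OF b Suc.prems(1)])
  also have "\<dots> = (\<Sum>S\<in>G. x (Suc N) ^ card S * minor (elem_sym x N) n (?l S) ?m)"
  proof (intro sum.cong refl arg_cong2[of _ _ _ _ "(*)"])
    fix S assume "S \<in> G"
    then have pos: "\<And>j. j \<in> S \<Longrightarrow> b j < c j"
      and up: "\<And>i j. i < j \<Longrightarrow> j < n \<Longrightarrow> c i = c j \<Longrightarrow> i \<in> S \<Longrightarrow> j \<in> S"
      unfolding G_def by blast+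
    have "tableau_sum N (column_diagram n b (\<lambda>j. c j - of_bool (j \<in> S))) x =
      minor (elem_sym x N) n (\<lambda>i. int (c i - of_bool (i \<in> S)) - int i) ?m"
    proof (rule Suc.IH)
      \<comment> \<open>Lowering on \<open>S\<close> could break monotonicity only for columns of
        equal length, where \<open>up\<close> prevents it.\<close>
      fix i j :: nat assume ij: "i \<le> j" "j < n"
      then have "c j \<le> c i" by (rule Suc.prems(1))
      then show "c j - of_bool (j \<in> S) \<le> c i - of_bool (i \<in> S)"
        using up[of i j] ij
        by (cases "i = j"; cases "c i = c j"; cases "i \<in> S"; cases "j \<in> S") simp_all
    next
      fix j assume "j < n"
      then show "b j \<le> c j - of_bool (j \<in> S)" using Suc.prems(2)[of j] pos[of j] by auto
    qed
    also have "\<dots> = minor (elem_sym x N) n (?l S) ?m"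
    proof (intro minor_cong refl)
      show "int (c i - of_bool (i \<in> S)) - int i = ?l S i" for i
        using pos[of i] by (cases "i \<in> S") simp_all
    qed
    finally show "tableau_sum N (column_diagram n b (\<lambda>j. c j - of_bool (j \<in> S))) x =
      minor (elem_sym x N) n (?l S) ?m" .
  qed
  also have "\<dots> = (\<Sum>S\<in>Pow {0..<n}. x (Suc N) ^ card S * minor (elem_sym x N) n (?l S) ?m)"
  proof (rule sum.mono_neutral_left)
    show "\<forall>S\<in>Pow {0..<n} - G. x (Suc N) ^ card S * minor (elem_sym x N) n (?l S) ?m = 0"
    proof
      fix S assume S: "S \<in> Pow {0..<n} - G"
      have "minor (elem_sym x N) n (?l S) ?m = 0"
      proof (cases "S \<subseteq> {j. j < n \<and> b j < c j}")
        \<comment> \<open>Column \<open>k\<close> has no cell to give up: lowering makes the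
          diagonal argument negative, and monotonicity spreads this over the whole block.\<close>
        case False
        then obtain k where "k \<in> S" "\<not> (k < n \<and> b k < c k)" by blast
        moreover from this have "k < n" using S by auto
        ultimately have k: "k \<in> S" "k < n" "b k = c k" using Suc.prems(2)[of k] by simp_all
        show ?thesis
        proof (rule minor_eq_0_block[OF \<open>k < n\<close>])
          fix i assume "k \<le> i" "i < n"
          then show "?l S i \<le> ?l S k" using Suc.prems(1)[of k i] k by (cases "i = k") auto
        next
          fix j assume "j \<le> k"
          then show "?m k \<le> ?m j" using b[of j k] k by simp
        qed (use k in \<open>auto simp: elem_sym_neg\<close>)
      next
        case True
        then obtain i j where ij: "i < j" "j < n" "c i = c j" "i \<in> S" "j \<notin> S"
          using S unfolding G_def by blast
        \<comment> \<open>Where membership in \<open>S\<close> drops between neighbours in a stretch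
          of constant \<open>c\<close>, the lowered row \<open>k\<close> has the same shift as the
          unlowered row \<open>k + 1\<close>.\<close>
        obtain k where k: "i \<le> k" "k < j" "k \<in> S" "Suc k \<notin> S"
        proof (rule ccontr)
          assume "\<not> thesis"
          with that have step: "Suc k \<in> S" if "i \<le> k" "k < j" "k \<in> S" for k using that by blast
          have "i \<le> j" using ij by simp
          then have "j \<in> S" by (induction rule: dec_induct) (use ij step in auto)
          with ij show False by simp
        qed
        have "c (Suc k) = c k"
          using Suc.prems(1)[of i k] Suc.prems(1)[of k "Suc k"] Suc.prems(1)[of "Suc k" j] ij k by simp
        then show ?thesis
          using ij k by (intro minor_eq_0_repeated[of k n "Suc k"]) auto
      qed
      then show "x (Suc N) ^ card S * minor (elem_sym x N) n (?l S) ?m = 0" by simp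
    qed
  qed (auto simp: G_def)
  also have "\<dots> = minor (elem_sym x (Suc N)) n (\<lambda>i. int (c i) - int i) ?m"
    by (rule minor_elem_sym_Suc[symmetric])
  finally show ?case .
qed

section \<open>Determinants for rectangles and near-rectangles\<close>

lemma skew_diagram_near_rectangle:
  assumes "\<alpha> \<ge> 1" "u \<le> w"
  shows "skew_diagram (replicate \<alpha> w @ [u] @ replicate m 0) (v # replicate k 0) =
    column_diagram w (\<lambda>j. of_bool (j < v)) (\<lambda>j. \<alpha> + of_bool (j < u))"
proof -
  have "part (replicate \<alpha> w @ [u] @ replicate m 0) i =
      (if i < \<alpha> then w else if i = \<alpha> then u else 0)" for i
    by (auto simp: part_def nth_append nth_Cons split: nat.split)
  moreover have "part (v # replicate k 0) i = (if i = 0 then v else 0)" for i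
    by (auto simp: part_def nth_Cons split: nat.split)
  ultimately show ?thesis
    using assms by (auto simp: skew_diagram_def column_diagram_def of_bool_def split: if_splits)
qed

lemma skew_diagram_rectangle:
  "skew_diagram (replicate \<alpha> w @ replicate m 0) [] = column_diagram w (\<lambda>j. 0) (\<lambda>j. \<alpha>)"
  by (auto simp: skew_diagram_def column_diagram_def part_def nth_append split: if_splits)

text \<open>In the transfer matrix, rows are starting heights and belong to the inner partition, so
  its minors match the transposed form.\<close>

lemma minor_transpose: "minor f n l m = det (mat n n (\<lambda>(i, j). f (l j - m i)))"
proof -
  have "transpose_mat (mat n n (\<lambda>(i, j). f (l i - m j))) = mat n n (\<lambda>(i, j). f (l j - m i))"
    by (rule eq_matI) auto
  then show ?thesis
    using det_transpose[of "mat n n (\<lambda>(i, j). f (l i - m j))" n] by (simp add: minor_def)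
qed

lemma schur_rectangle_det:
  "schur N (replicate \<alpha> w @ replicate m 0) x =
    det (mat w w (\<lambda>(i, j). elem_sym x N (int \<alpha> - int j + int i)))"
proof -
  have "schur N (replicate \<alpha> w @ replicate m 0) x =
      minor (elem_sym x N) w (\<lambda>i. int \<alpha> - int i) (\<lambda>j. int 0 - int j)"
    unfolding schur_def skew_schur_tableau_sum skew_diagram_rectangle
    by (rule dual_jacobi_trudi) auto
  then show ?thesis by (simp add: minor_transpose)
qed

text \<open>Skipping \<open>u\<close> and \<open>v\<close> shifts the later indices by 1, which
  agrees with the extra cells in the first \<open>u\<close> and the removed cells in the first
  \<open>v\<close> columns up to a 1 that cancels. So this is the matrix of the rectangle of width
  \<open>w + 1\<close> with row \<open>v\<close> and column \<open>u\<close> deleted.\<close>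

lemma skew_schur_near_rectangle_det:
  assumes "\<alpha> \<ge> 1" "u \<le> w"
  shows "skew_schur N (replicate \<alpha> w @ [u] @ replicate m 0) (v # replicate k 0) x =
    det (mat w w (\<lambda>(i, j).
      elem_sym x N (int \<alpha> - int (insert_index u j) + int (insert_index v i))))"
proof -
  have "skew_schur N (replicate \<alpha> w @ [u] @ replicate m 0) (v # replicate k 0) x =
      minor (elem_sym x N) w (\<lambda>i. int (\<alpha> + of_bool (i < u)) - int i) (\<lambda>j. int (of_bool (j < v)) - int j)"
    unfolding skew_schur_tableau_sum skew_diagram_near_rectangle[OF assms]
    by (rule dual_jacobi_trudi) (use assms in \<open>auto simp: of_bool_def\<close>)
  also have "\<dots> = det (mat w w (\<lambda>(i, j).
      elem_sym x N (int \<alpha> - int (insert_index u j) + int (insert_index v i))))"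
    unfolding minor_transpose
    by (intro arg_cong[of _ _ det] eq_matI) (auto simp: insert_index_def algebra_simps)
  finally show ?thesis .
qed

section \<open>The transfer matrix\<close>

text \<open>The weights \<open>p\<close> and \<open>q\<close> are arbitrary beyond \<alpha> and
  \<beta>, so steps outside the step set have to be cut off explicitly.\<close>

definition jump_weight :: "nat \<Rightarrow> nat \<Rightarrow> (nat \<Rightarrow> 'a :: zero) \<Rightarrow> (nat \<Rightarrow> 'a) \<Rightarrow> int \<Rightarrow> 'a" where
  "jump_weight \<alpha> \<beta> p q d = (if d \<in> {- int \<beta>..int \<alpha>} then step_weight p q d else 0)"

lemma all_le_Suc_iff: "(\<forall>k\<le>Suc n. P k) \<longleftrightarrow> P 0 \<and> (\<forall>k\<le>n. P (Suc k))"
  by (metis Suc_le_mono le0 not0_implies_Suc)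

lemma slit_paths_0: "slit_paths w \<alpha> \<beta> u v 0 = (if u = v \<and> u \<le> w then {[]} else {})"
  by (auto simp: slit_paths_def)

lemma Cons_in_slit_paths_iff:
  assumes "u \<le> w"
  shows "d # ds \<in> slit_paths w \<alpha> \<beta> u v (Suc n) \<longleftrightarrow> d \<in> {- int \<beta>..int \<alpha>} \<and>
    int u + d \<in> {0..int w} \<and> ds \<in> slit_paths w \<alpha> \<beta> (nat (int u + d)) v n"
proof -
  have "(\<forall>k\<le>Suc n. int u + sum_list (take k (d # ds)) \<in> {0..int w}) \<longleftrightarrow>
    int u + d \<in> {0..int w} \<and> (\<forall>k\<le>n. int (nat (int u + d)) + sum_list (take k ds) \<in> {0..int w})"
    (is "?l \<longleftrightarrow> ?r")
  proof -
    have "?l \<longleftrightarrow> (\<forall>k\<le>n. int u + d + sum_list (take k ds) \<in> {0..int w})"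
      using assms unfolding all_le_Suc_iff by (simp add: add.assoc)
    \<comment> \<open>The instance \<open>k = 0\<close> keeps the first step inside the slit, so
      that \<open>nat\<close> does not truncate the new height.\<close>
    also have "\<dots> \<longleftrightarrow> int u + d \<in> {0..int w} \<and>
        (\<forall>k\<le>n. int u + d + sum_list (take k ds) \<in> {0..int w})"
      by (auto dest: spec[of _ 0])
    also have "\<dots> \<longleftrightarrow> ?r" by (intro conj_cong refl) simp
    finally show ?thesis .
  qed
  then show ?thesis by (auto simp: slit_paths_def)
qed

text \<open>Splits off the first step; \<open>k\<close> is the height it reaches. Zero jump weights
  extend the sum to all heights of the slit.\<close>

lemma sum_slit_paths_Suc:
  fixes p q :: "nat \<Rightarrow> 'a :: comm_ring_1"
  assumes "u \<le> w"
  shows "(\<Sum>ds\<in>slit_paths w \<alpha> \<beta> u v (Suc n). path_weight p q ds) =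
    (\<Sum>k=0..<Suc w. jump_weight \<alpha> \<beta> p q (int k - int u) *
       (\<Sum>ds\<in>slit_paths w \<alpha> \<beta> k v n. path_weight p q ds))"
proof -
  let ?K = "{k. k \<le> w \<and> int k - int u \<in> {- int \<beta>..int \<alpha>}}"
  have "(\<Sum>ds\<in>slit_paths w \<alpha> \<beta> u v (Suc n). path_weight p q ds) =
    (\<Sum>(k, ds)\<in>(SIGMA k:?K. slit_paths w \<alpha> \<beta> k v n).
       step_weight p q (int k - int u) * path_weight p q ds)"
  proof (rule sum.reindex_bij_witness[of _ "\<lambda>(k, ds). (int k - int u) # ds"
        "\<lambda>ds. (nat (int u + hd ds), tl ds)"])
    fix es assume es: "es \<in> slit_paths w \<alpha> \<beta> u v (Suc n)"
    then obtain d ds where [simp]: "es = d # ds" by (cases es) (auto simp: slit_paths_def)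
    note * = es[unfolded \<open>es = d # ds\<close> Cons_in_slit_paths_iff[OF assms]]
    show "(case (nat (int u + hd es), tl es) of (k, ds) \<Rightarrow> (int k - int u) # ds) = es"
      "(nat (int u + hd es), tl es) \<in> (SIGMA k:?K. slit_paths w \<alpha> \<beta> k v n)"
      "(case (nat (int u + hd es), tl es) of (k, ds) \<Rightarrow>
         step_weight p q (int k - int u) * path_weight p q ds) = path_weight p q es"
      using * by (auto simp: path_weight_def)
  next
    fix kds assume "kds \<in> (SIGMA k:?K. slit_paths w \<alpha> \<beta> k v n)"
    then show "(nat (int u + hd (case kds of (k, ds) \<Rightarrow> (int k - int u) # ds)),
        tl (case kds of (k, ds) \<Rightarrow> (int k - int u) # ds)) = kds"
      "(case kds of (k, ds) \<Rightarrow> (int k - int u) # ds) \<in> slit_paths w \<alpha> \<beta> u v (Suc n)"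
      by (auto simp: Cons_in_slit_paths_iff[OF assms])
  qed
  also have "\<dots> = (\<Sum>k\<in>?K. step_weight p q (int k - int u) *
       (\<Sum>ds\<in>slit_paths w \<alpha> \<beta> k v n. path_weight p q ds))"
    by (subst sum.Sigma[symmetric]) (auto simp: finite_slit_paths sum_distrib_left)
  also have "\<dots> = (\<Sum>k=0..<Suc w. jump_weight \<alpha> \<beta> p q (int k - int u) *
       (\<Sum>ds\<in>slit_paths w \<alpha> \<beta> k v n. path_weight p q ds))"
    by (intro sum.mono_neutral_cong_left) (auto simp: jump_weight_def)
  finally show ?thesis .
qed

text \<open>This is \<open>1 - t A\<close>. Its entries are polynomials in \<open>t\<close>, since
  these map both to power series, where the generating functions live, and to the closure of the
  rational functions, where the roots live.\<close>

definition transfer_mat :: "nat \<Rightarrow> nat \<Rightarrow> nat \<Rightarrow> (nat \<Rightarrow> 'a :: comm_ring_1) \<Rightarrow> (nat \<Rightarrow> 'a) \<Rightarrow> 'a poly mat"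
  where "transfer_mat w \<alpha> \<beta> p q =
    mat (Suc w) (Suc w) (\<lambda>(i, j). [:of_bool (i = j), - jump_weight \<alpha> \<beta> p q (int j - int i):])"

text \<open>Constant coefficients come from the empty path; all others cancel by splitting off the
  first step.\<close>

lemma transfer_mat_mult_slit_gf:
  fixes p q :: "nat \<Rightarrow> 'a :: comm_ring_1"
  shows "map_mat fps_of_poly (transfer_mat w \<alpha> \<beta> p q) *
      mat (Suc w) (Suc w) (\<lambda>(i, j). slit_gf w \<alpha> \<beta> p q i j) = 1\<^sub>m (Suc w)"
proof (rule eq_matI)
  fix u v assume "u < dim_row (1\<^sub>m (Suc w) :: 'a fps mat)" "v < dim_col (1\<^sub>m (Suc w) :: 'a fps mat)"
  then have uv: "u < Suc w" "v < Suc w" by auto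
  let ?a = "\<lambda>k. jump_weight \<alpha> \<beta> p q (int k - int u)" and ?G = "\<lambda>k. slit_gf w \<alpha> \<beta> p q k v"
  have "fps_of_poly [:of_bool (u = k), - ?a k:] * ?G k =
      (if u = k then ?G u else 0) - fps_X * (fps_const (?a k) * ?G k)" for k
    by (simp add: fps_of_poly_pCons algebra_simps flip: fps_const_neg)
  then have "(\<Sum>k=0..<Suc w. fps_of_poly [:of_bool (u = k), - ?a k:] * ?G k) =
      ?G u - fps_X * (\<Sum>k=0..<Suc w. fps_const (?a k) * ?G k)"
    using uv by (simp only: sum_subtractf sum_distrib_left) simp
  also have "\<dots> = of_bool (u = v)"
  proof (rule fps_ext)
    fix n
    show "(?G u - fps_X * (\<Sum>k=0..<Suc w. fps_const (?a k) * ?G k)) $ n = (of_bool (u = v) :: 'a fps) $ n"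
    proof (cases n)
      case 0
      then show ?thesis using uv by (simp add: slit_gf_def slit_paths_0 path_weight_def)
    next
      case (Suc m)
      then show ?thesis
        using uv by (simp add: slit_gf_def sum_slit_paths_Suc fps_sum_nth del: sum.op_ivl_Suc)
    qed
  qed
  finally show "(map_mat fps_of_poly (transfer_mat w \<alpha> \<beta> p q) *
      mat (Suc w) (Suc w) (\<lambda>(i, j). slit_gf w \<alpha> \<beta> p q i j)) $$ (u, v) = 1\<^sub>m (Suc w) $$ (u, v)"
    using uv by (simp add: transfer_mat_def scalar_prod_def del: sum.op_ivl_Suc)
qed (simp_all add: transfer_mat_def)

section \<open>Cramer's rule and ring homomorphisms\<close>

lemma (in comm_ring_hom) cofactor_map_mat: "cofactor (map_mat hom A) i j = hom (cofactor A i j)"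
proof -
  have "mat_delete (map_mat hom A) i j = map_mat hom (mat_delete A i j)"
    by (rule eq_matI) (auto simp: mat_delete_def)
  then show ?thesis by (simp add: cofactor_def hom_distribs)
qed

lemma comm_ring_hom_fps_of_poly: "comm_ring_hom (fps_of_poly :: 'a :: comm_ring_1 poly \<Rightarrow> 'a fps)"
  by unfold_locales (simp_all add: fps_of_poly_add fps_of_poly_mult)

lemma comm_ring_hom_poly_0: "comm_ring_hom (\<lambda>p :: 'a :: comm_ring_1 poly. poly p 0)"
  by unfold_locales simp_all

lemma comm_ring_hom_to_ac_to_fract:
  "comm_ring_hom (\<lambda>p :: 'a :: field poly. to_ac (to_fract p) :: 'a ratfun_closure)"
  by unfold_locales simp_all

text \<open>Multiplying the inverse relation by the adjugate is Cramer's rule without division; it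
  yields the numerator and denominator that \<open>ratfun_expansion\<close> asks for.\<close>

lemma det_transfer_mat_mult_slit_gf:
  fixes p q :: "nat \<Rightarrow> 'a :: comm_ring_1"
  assumes "u \<le> w" "v \<le> w"
  shows "fps_of_poly (det (transfer_mat w \<alpha> \<beta> p q)) * slit_gf w \<alpha> \<beta> p q u v =
    fps_of_poly (cofactor (transfer_mat w \<alpha> \<beta> p q) v u)"
proof -
  interpret comm_ring_hom "fps_of_poly :: 'a poly \<Rightarrow> 'a fps" by (rule comm_ring_hom_fps_of_poly)
  let ?T = "transfer_mat w \<alpha> \<beta> p q"
  let ?F = "map_mat fps_of_poly ?T"
  let ?G = "mat (Suc w) (Suc w) (\<lambda>(i, j). slit_gf w \<alpha> \<beta> p q i j)"
  have F: "?F \<in> carrier_mat (Suc w) (Suc w)" by (simp add: transfer_mat_def)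
  have G: "?G \<in> carrier_mat (Suc w) (Suc w)" by simp
  note adj = adj_mat[OF F]
  have "det ?F \<cdot>\<^sub>m ?G = (adj_mat ?F * ?F) * ?G"
    unfolding adj(3) by (simp add: mult_smult_assoc_mat[OF one_carrier_mat G])
  also have "\<dots> = adj_mat ?F * (?F * ?G)" by (rule assoc_mult_mat[OF adj(1) F G])
  also have "\<dots> = adj_mat ?F" using adj(1) by (simp add: transfer_mat_mult_slit_gf)
  finally have "(det ?F \<cdot>\<^sub>m ?G) $$ (u, v) = adj_mat ?F $$ (u, v)" by simp
  then show ?thesis
    using assms by (simp add: adj_mat_def transfer_mat_def flip: cofactor_map_mat)
qed

text \<open>At \<open>t = 0\<close> the matrix is the identity, so the determinant has constant term
  1.\<close>

lemma det_transfer_mat_neq_0: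
  fixes p q :: "nat \<Rightarrow> 'a :: comm_ring_1"
  shows "det (transfer_mat w \<alpha> \<beta> p q) \<noteq> 0"
proof -
  interpret comm_ring_hom "\<lambda>p :: 'a poly. poly p 0" by (rule comm_ring_hom_poly_0)
  have "map_mat (\<lambda>p. poly p 0) (transfer_mat w \<alpha> \<beta> p q) = 1\<^sub>m (Suc w)"
    by (rule eq_matI) (auto simp: transfer_mat_def)
  then have "poly (det (transfer_mat w \<alpha> \<beta> p q)) 0 = 1" by (metis hom_det det_one)
  then show ?thesis by auto
qed

section \<open>The kernel and its roots\<close>

text \<open>The link to the transfer matrix: the coefficient at \<open>\<beta> + d\<close> has the
  form of its entry for a jump by \<open>d\<close>.\<close>

lemma coeff_kernel_poly:
  "coeff (kernel_poly \<alpha> \<beta> p q t) k =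
    of_bool (k = \<beta>) - t * jump_weight \<alpha> \<beta> p q (int k - int \<beta>)"
proof -
  have "(\<Sum>a=0..\<alpha>. coeff (monom (p a) (a + \<beta>)) k) = (if \<beta> \<le> k \<and> k \<le> \<alpha> + \<beta> then p (k - \<beta>) else 0)"
  proof -
    have "(\<Sum>a=0..\<alpha>. coeff (monom (p a) (a + \<beta>)) k) = (\<Sum>a=0..\<alpha>. if a = k - \<beta> \<and> \<beta> \<le> k then p a else 0)"
      by (intro sum.cong) auto
    then show ?thesis by auto
  qed
  moreover have "(\<Sum>b=1..\<beta>. coeff (monom (q b) (\<beta> - b)) k) = (if k < \<beta> then q (\<beta> - k) else 0)"
  proof -
    have "(\<Sum>b=1..\<beta>. coeff (monom (q b) (\<beta> - b)) k) = (\<Sum>b=1..\<beta>. if b = \<beta> - k then q b else 0)"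
      by (intro sum.cong) auto
    then show ?thesis by auto
  qed
  moreover have "nat (int k - int \<beta>) = k - \<beta>" "nat (int \<beta> - int k) = \<beta> - k" by auto
  ultimately show ?thesis
    by (auto simp: kernel_poly_def coeff_sum jump_weight_def step_weight_def algebra_simps)
qed

lemma proots_prod_mset_linear_factors:
  fixes A :: "'b :: idom multiset"
  shows "proots (\<Prod>x\<in>#A. [:- x, 1:]) = A"
proof (induction A)
  case (add x A)
  have "(\<Prod>x\<in>#A. [:- x, 1:]) \<noteq> 0" by (auto simp: prod_mset_zero_iff)
  with add show ?case by (simp add: proots_mult del: mult_pCons_left)
qed simp

text \<open>Over an algebraically closed field the polynomial splits, and its multiset of roots
  fixes the linear factors. As \<alpha> \<ge> 1, the term \<open>z ^ \<beta>\<close> does not touch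
  the leading coefficient.\<close>

lemma kernel_poly_factorization:
  fixes p q :: "nat \<Rightarrow> 'b :: alg_closed_field"
  assumes "t * p \<alpha> \<noteq> 0"
    and roots: "image_mset z (mset_set {1..\<alpha> + \<beta>}) = proots (kernel_poly \<alpha> \<beta> p q t)"
  assumes "\<alpha> \<ge> 1"
  shows "kernel_poly \<alpha> \<beta> p q t = smult (- t * p \<alpha>) (\<Prod>i=1..\<alpha> + \<beta>. [:- z i, 1:])"
proof -
  let ?P = "kernel_poly \<alpha> \<beta> p q t"
  have lead: "coeff ?P (\<alpha> + \<beta>) = - t * p \<alpha>"
    using assms(3) by (simp add: coeff_kernel_poly jump_weight_def step_weight_def)
  have "degree ?P = \<alpha> + \<beta>"
  proof (rule antisym)
    show "degree ?P \<le> \<alpha> + \<beta>" by (rule degree_le) (auto simp: coeff_kernel_poly jump_weight_def)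
    show "\<alpha> + \<beta> \<le> degree ?P" using assms(1) lead by (intro le_degree) auto
  qed
  with lead have lc: "lead_coeff ?P = - t * p \<alpha>" by simp
  then have "?P \<noteq> 0" using assms(1) by auto
  from alg_closed_imp_factorization[OF this] obtain A
    where A: "?P = smult (- t * p \<alpha>) (\<Prod>x\<in>#A. [:- x, 1:])" unfolding lc by blast
  have "proots ?P = A"
    unfolding A using assms(1) by (simp add: proots_prod_mset_linear_factors)
  then have "A = image_mset z (mset_set {1..\<alpha> + \<beta>})" using roots by simp
  then show ?thesis
    using A by (simp add: image_mset.compositionality o_def prod_unfold_prod_mset)
qed

section \<open>Sign patterns in determinants and cofactors\<close>

lemma det_scale_rows_cols:
  "det (mat n n (\<lambda>(i, j). r i * s j * a i j)) =
    (\<Prod>i=0..<n. r i) * (\<Prod>j=0..<n. s j) * det (mat n n (\<lambda>(i, j). a i j))"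
proof -
  have "(\<Prod>i=0..<n. s (p i)) = (\<Prod>j=0..<n. s j)" if "p permutes {0..<n}" for p
    using prod.permute[OF that, of s] by (simp add: o_def)
  then show ?thesis by (simp add: det_mat prod.distrib sum_distrib_left mult_ac)
qed

text \<open>The cofactor sign supplies the factor of the omitted index.\<close>

lemma prod_minus_one_insert_index:
  assumes "v \<le> w"
  shows "(- 1) ^ v * (\<Prod>i=0..<w. (- 1) ^ insert_index v i) =
    (\<Prod>i=0..<Suc w. (- 1) ^ i :: 'b :: comm_ring_1)"
proof -
  have "(\<Prod>i=0..<w. (- 1) ^ insert_index v i) =
      (\<Prod>i\<in>insert_index v ` {0..<w}. (- 1) ^ i :: 'b)"
    by (subst prod.reindex) (auto simp: insert_index_inj_on)
  also have "insert_index v ` {0..<w} = {0..<Suc w} - {v}"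
    by (rule insert_index_image) (use assms in simp)
  finally show ?thesis using assms by (subst (2) prod.remove[of _ v]) auto
qed

lemma prod_minus_one_square: "(\<Prod>i\<in>A. (- 1) ^ i) * (\<Prod>i\<in>A. (- 1) ^ i) = (1 :: 'b :: comm_ring_1)"
  by (simp flip: prod.distrib power_add mult_2 add: power_mult)

text \<open>The signs split into a row part and a column part with equal products, which
  cancel.\<close>

lemma det_checkerboard:
  "det (mat n n (\<lambda>(i, j). \<kappa> * (- 1) ^ (i + j) * f (int j - int i))) =
    \<kappa> ^ n * det (mat n n (\<lambda>(i, j). f (int j - int i)))"
  for \<kappa> :: "'b :: comm_ring_1"
proof -
  have "det (mat n n (\<lambda>(i, j). \<kappa> * (- 1) ^ (i + j) * f (int j - int i))) =
      det (mat n n (\<lambda>(i, j). (\<kappa> * (- 1) ^ i) * (- 1) ^ j * f (int j - int i)))"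
    by (simp add: power_add mult_ac)
  also have "\<dots> = \<kappa> ^ n * ((\<Prod>i=0..<n. (- 1) ^ i) * (\<Prod>i=0..<n. (- 1) ^ i)) *
      det (mat n n (\<lambda>(i, j). f (int j - int i)))"
    by (simp only: det_scale_rows_cols prod.distrib) (simp add: mult_ac)
  finally show ?thesis by (simp add: prod_minus_one_square)
qed

text \<open>Rows and columns lose one sign each, and \<open>(- 1) ^ (v + u)\<close> restores both;
  the rest cancels as for the full determinant.\<close>

lemma cofactor_checkerboard:
  fixes \<kappa> :: "'b :: comm_ring_1"
  assumes "u \<le> w" "v \<le> w"
  shows "cofactor (mat (Suc w) (Suc w) (\<lambda>(i, j). \<kappa> * (- 1) ^ (i + j) * f (int j - int i))) v u =
    \<kappa> ^ w * det (mat w w (\<lambda>(i, j). f (int (insert_index u j) - int (insert_index v i))))"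
    (is "cofactor ?M v u = _ * det ?D")
proof -
  have "mat_delete ?M v u = mat w w (\<lambda>(i, j). (\<kappa> * (- 1) ^ insert_index v i) * (- 1) ^ insert_index u j *
      f (int (insert_index u j) - int (insert_index v i)))"
    by (rule eq_matI) (auto simp: mat_delete_def insert_index_def power_add mult_ac)
  then have "cofactor ?M v u = \<kappa> ^ w *
      (((- 1) ^ v * (\<Prod>i=0..<w. (- 1) ^ insert_index v i)) *
       ((- 1) ^ u * (\<Prod>i=0..<w. (- 1) ^ insert_index u i))) * det ?D"
    by (simp only: cofactor_def det_scale_rows_cols prod.distrib) (simp add: power_add mult_ac)
  then show ?thesis by (simp add: prod_minus_one_insert_index assms prod_minus_one_square del: prod.op_ivl_Suc)
qed

theorem theorem1:
  fixes \<alpha> \<beta> w u v :: nat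
    and p q :: "nat \<Rightarrow> 'a :: field"
    and z :: "nat \<Rightarrow> 'a ratfun_closure"
  assumes "\<alpha> \<ge> 1" and "\<beta> \<ge> 1"
    and "p \<alpha> \<noteq> 0" and "q \<beta> \<noteq> 0"
    and "u \<le> w" and "v \<le> w"
    and roots: "image_mset z (mset_set {1..\<alpha> + \<beta>}) =
      proots (kernel_poly \<alpha> \<beta> (\<lambda>a. const_ac (p a)) (\<lambda>b. const_ac (q b)) var_t)"
  shows "\<exists>R. ratfun_expansion R (slit_gf w \<alpha> \<beta> p q u v) \<and>
    to_ac R =
      (-1) powi (1 - int \<alpha>) / (var_t * const_ac (p \<alpha>)) *
      (skew_schur (\<alpha> + \<beta>) (replicate \<alpha> w @ [u] @ replicate (\<beta> - 1) 0)
                          (v # replicate (\<alpha> + \<beta> - 1) 0) z /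
       schur (\<alpha> + \<beta>) (replicate \<alpha> (w + 1) @ replicate \<beta> 0) z)"
proof -
  let ?hom = "\<lambda>p :: 'a poly. to_ac (to_fract p) :: 'a ratfun_closure"
  interpret comm_ring_hom ?hom by (rule comm_ring_hom_to_ac_to_fract)
  let ?T = "transfer_mat w \<alpha> \<beta> p q"
  let ?N = "\<alpha> + \<beta>"
  let ?p = "\<lambda>a. const_ac (p a) :: 'a ratfun_closure" and ?q = "\<lambda>b. const_ac (q b) :: 'a ratfun_closure"
  define t where "t = (var_t :: 'a ratfun_closure)"
  \<comment> \<open>The factor common to all entries: the leading coefficient of the kernel
    polynomial times the part of Vieta's sign that does not depend on \<open>i\<close> and
    \<open>j\<close>.\<close>
  define \<kappa> where "\<kappa> = - t * ?p \<alpha> * (- 1) ^ \<alpha>"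
  have "t \<noteq> 0" "?p \<alpha> \<noteq> 0" using assms by (auto simp: t_def var_t_def const_ac_def)
  then have "\<kappa> \<noteq> 0" by (simp add: \<kappa>_def)

  have entry: "of_bool (i = j) - t * jump_weight \<alpha> \<beta> ?p ?q (int j - int i) =
      \<kappa> * (- 1) ^ (i + j) * elem_sym z ?N (int \<alpha> - (int j - int i))" for i j :: nat
  \<comment> \<open>A jump below \<open>- \<beta>\<close> belongs to no exponent \<open>k\<close>,
    but then both sides vanish; jumps above \<alpha> are covered by coefficients beyond the
    degree.\<close>
  proof (cases "int j - int i < - int \<beta>")
    case True
    then show ?thesis using assms by (auto simp: jump_weight_def elem_sym_gt)
  next
    case False
    define k where "k = nat (int \<beta> + (int j - int i))"
    have k: "int k = int \<beta> + (int j - int i)" using False by (simp add: k_def)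
    then have "k + i = \<beta> + j" by simp
    then have "even (?N + k) \<longleftrightarrow> even (\<alpha> + (i + j))" by presburger
    then have sign: "(- 1) ^ (?N + k) = (- 1) ^ \<alpha> * ((- 1) ^ (i + j) :: 'a ratfun_closure)"
      unfolding power_add[symmetric] by (simp only: minus_one_power_iff)
    have "of_bool (i = j) - t * jump_weight \<alpha> \<beta> ?p ?q (int j - int i) = coeff (kernel_poly \<alpha> \<beta> ?p ?q t) k"
      using k by (simp add: coeff_kernel_poly)
    also have "\<dots> = \<kappa> * (- 1) ^ (i + j) * elem_sym z ?N (int ?N - int k)"
      using kernel_poly_factorization[of t ?p \<alpha> z \<beta> ?q] roots assms(1) \<open>t \<noteq> 0\<close> \<open>?p \<alpha> \<noteq> 0\<close>
      by (simp add: coeff_prod_linear_factors[unfolded One_nat_def] sign \<kappa>_def t_def mult_ac)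
    also have "int ?N - int k = int \<alpha> - (int j - int i)" using k by simp
    finally show ?thesis .
  qed
  have "?hom [:of_bool (i = j), - jump_weight \<alpha> \<beta> p q (int j - int i):] =
      of_bool (i = j) - t * jump_weight \<alpha> \<beta> ?p ?q (int j - int i)" for i j :: nat
  proof -
    have "[:of_bool (i = j), - jump_weight \<alpha> \<beta> p q (int j - int i):] =
        of_bool (i = j) - [:0, 1:] * [:jump_weight \<alpha> \<beta> p q (int j - int i):]"
      by (simp add: of_bool_def one_pCons)
    then show ?thesis
      by (simp only: hom_distribs)
         (simp add: t_def var_t_def jump_weight_def step_weight_def const_ac_def)
  qed
  then have T: "map_mat ?hom ?T = mat (Suc w) (Suc w) (\<lambda>(i, j).
      \<kappa> * (- 1) ^ (i + j) * elem_sym z ?N (int \<alpha> - (int j - int i)))"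
    unfolding entry transfer_mat_def by (intro eq_matI) auto
  \<comment> \<open>As \<open>det ?T\<close> is nonzero, so is the Schur function in the
    denominator.\<close>
  have det: "?hom (det ?T) = \<kappa> ^ Suc w * schur ?N (replicate \<alpha> (w + 1) @ replicate \<beta> 0) z"
    unfolding hom_det[symmetric] T schur_rectangle_det det_checkerboard[where f = "\<lambda>d. elem_sym z ?N (int \<alpha> - d)"]
    by (simp add: algebra_simps)
  have cof: "?hom (cofactor ?T v u) = \<kappa> ^ w *
      skew_schur ?N (replicate \<alpha> w @ [u] @ replicate (\<beta> - 1) 0) (v # replicate (?N - 1) 0) z"
    unfolding cofactor_map_mat[symmetric] T skew_schur_near_rectangle_det[OF assms(1,5)]
      cofactor_checkerboard[OF assms(5,6), where f = "\<lambda>d. elem_sym z ?N (int \<alpha> - d)"]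
    by (simp add: algebra_simps)

  define R where "R = to_fract (cofactor ?T v u) / to_fract (det ?T)"
  have "ratfun_expansion R (slit_gf w \<alpha> \<beta> p q u v)"
    unfolding ratfun_expansion_def R_def
    using det_transfer_mat_neq_0 det_transfer_mat_mult_slit_gf[OF assms(5,6)] by blast
  \<comment> \<open>The determinant carries one factor \<kappa> more than the cofactor, which leaves
    the inverse of \<kappa>.\<close>
  moreover have scalar: "(- 1) powi (1 - int \<alpha>) / (t * ?p \<alpha>) = inverse \<kappa>"
    by (cases "even \<alpha>") (auto simp: \<kappa>_def power_int_diff field_simps)
  have "to_ac R = (-1) powi (1 - int \<alpha>) / (t * ?p \<alpha>) *
      (skew_schur ?N (replicate \<alpha> w @ [u] @ replicate (\<beta> - 1) 0) (v # replicate (?N - 1) 0) z /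
       schur ?N (replicate \<alpha> (w + 1) @ replicate \<beta> 0) z)"
    unfolding R_def to_ac_divide det cof scalar using \<open>\<kappa> \<noteq> 0\<close> by (simp add: field_simps)
  ultimately show ?thesis unfolding t_def by blast
qed

end
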